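(* The family of finite noncyclic groups of prime power order is maximal cyclic bounded; that is, for every natural number $n$ there are, up to isomorphism, only finitely many finite noncyclic groups $G$ of prime power order (the prime being arbitrary) such that $\lambda(G)\leqslant n$.
   Context: A subgroup $H$ of a finite group $G$ is called a maximal cyclic subgroup if it is cyclic and not properly contained in any cyclic subgroup of $G$. $\lambda(G)$ denotes the number of maximal cyclic subgroups of $G$. A family $\mathscr{F}$ of finite groups is called maximal cyclic bounded (MCB) if, for every natural number $n$, there are only finitely many groups $G$ in $\mathscr{F}$ up to isomorphism with $\lambda(G)\leqslant n$. *)

theory Defs
  imports "HOL-Algebra.Elementary_Groups" "HOL-Computational_Algebra.Primes"
begin

definition cyclic_subgroup :: "'a set \<Rightarrow> ('a, 'b) monoid_scheme \<Rightarrow> bool" where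
  "cyclic_subgroup H G \<longleftrightarrow> subgroup H G \<and> cyclic_group (G\<lparr>carrier := H\<rparr>)"

definition maximal_cyclic_subgroup :: "'a set \<Rightarrow> ('a, 'b) monoid_scheme \<Rightarrow> bool" where
  "maximal_cyclic_subgroup H G \<longleftrightarrow>
     cyclic_subgroup H G \<and> \<not> (\<exists>K. cyclic_subgroup K G \<and> H \<subset> K)"

text \<open>The number \<open>\<lambda>(G)\<close>; only meant for finite \<open>G\<close>, where the set below is finite.\<close>

definition num_maximal_cyclic :: "('a, 'b) monoid_scheme \<Rightarrow> nat" where
  "num_maximal_cyclic G = card {H. maximal_cyclic_subgroup H G}"

definition finitely_many_up_to_iso :: "'a monoid set \<Rightarrow> bool" where
  "finitely_many_up_to_iso \<G> \<longleftrightarrow> finite (\<G> // {(G, H). G \<in> \<G> \<and> H \<in> \<G> \<and> G \<cong> H})"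

definition maximal_cyclic_bounded :: "'a monoid set \<Rightarrow> bool" where
  "maximal_cyclic_bounded \<F> \<longleftrightarrow>
     (\<forall>G\<in>\<F>. group G \<and> finite (carrier G)) \<and>
     (\<forall>n::nat. finitely_many_up_to_iso {G \<in> \<F>. num_maximal_cyclic G \<le> n})"

text \<open>
  A family of groups is a set of groups with carriers in one type \<open>'a\<close>. For \<open>'a = nat\<close>
  (or any infinite type) every finite group is isomorphic to one of this kind, so a
  statement about the family below for arbitrary \<open>'a\<close> covers all finite groups.
\<close>

definition noncyclic_prime_power_groups :: "'a monoid set" where
  "noncyclic_prime_power_groups =
     {G. group G \<and> finite (carrier G) \<and> \<not> cyclic_group G \<and>
         (\<exists>(p::nat) (k::nat). prime p \<and> order G = p ^ k)}"

end

(* Each element of G lies in a maximal cyclic subgroup, and a generator of one lies in no other, so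
   the n maximal cyclic subgroups form an irredundant cover and their intersection D has index at
   most n!. If D had an element z of order divisible by p^2, every element of G would lie in a cyclic
   group together with z, which forces G to be cyclic. So D is cyclic of exponent dividing p,
   giving |D| <= p, and D is proper, giving p <= |G : D| <= n!; hence |G| <= (n!)^2. *)

theory Submission
  imports Defs "HOL-Algebra.Multiplicative_Group" "HOL-Algebra.Group_Action" "HOL-Number_Theory.Cong"
begin

text \<open>The intersection D need not be trivial: in the quaternion group of order 8 the central
  involution lies in all three maximal cyclic subgroups. There c of order 4 is inverted by y, so u =
  3 and 1 + u = 4, whence (c^t y)^2 = y^2 for every t and no choice of t yields a new involution.
  The threshold p^2 excludes this behaviour for all primes at once: if conjugation c \<mapsto> c^u
  fixes an element of <c> whose order is divisible by p^2, then u is 1 modulo p^2 and 1 + u + ... +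
  u^(p-1) is divisible by p exactly once. Elements of order p in D therefore have to be tolerated,
  and since the prime is not fixed in advance, p itself needs a bound in terms of n.\<close>

section \<open>Finitely many isomorphism types of bounded order\<close>

text \<open>Equivalent elements may have different codes. This suits codes that depend on arbitrary
  choices, such as a numbering of the elements of a group.\<close>

lemma finite_quotient_if_code:
  assumes r: "equiv A r" and fin: "finite (f ` A)"
    and code: "\<And>x y. x \<in> A \<Longrightarrow> y \<in> A \<Longrightarrow> f x = f y \<Longrightarrow> (x, y) \<in> r"
  shows "finite (A // r)"
proof -
  define g where "g t = r `` {SOME x. x \<in> A \<and> f x = t}" for t
  have "A // r \<subseteq> g ` f ` A"
  proof
    fix X assume "X \<in> A // r"
    then obtain x where x: "x \<in> A" "X = r `` {x}" by (auto elim: quotientE)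
    let ?y = "SOME y. y \<in> A \<and> f y = f x"
    have "?y \<in> A \<and> f ?y = f x" using x(1) by (intro someI[of "\<lambda>y. y \<in> A \<and> f y = f x" x]) simp
    then have "r `` {x} = r `` {?y}"
      using code[of x ?y] x(1) r by (intro equiv_class_eq[OF r]) auto
    then show "X \<in> g ` f ` A" using x by (auto simp: g_def)
  qed
  then show ?thesis using fin finite_surj by blast
qed

text \<open>The triples form the graph of multiplication written in labels. Since the labels are
  injective they can be decoded, and sending each element to the one with the same label respects
  products.\<close>

lemma is_iso_if_same_table:
  assumes G: "group G" and H: "group H"
    and inj: "inj_on f (carrier G)" "inj_on g (carrier H)"
    and table: "(\<lambda>(a, b). (f a, f b, f (a \<otimes>\<^bsub>G\<^esub> b))) ` (carrier G \<times> carrier G)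
      = (\<lambda>(a, b). (g a, g b, g (a \<otimes>\<^bsub>H\<^esub> b))) ` (carrier H \<times> carrier H)" (is "?T = ?U")
  shows "G \<cong> H"
proof -
  interpret G: group G by fact
  interpret H: group H by fact
  have "fst ` ?T = f ` carrier G" "fst ` ?U = g ` carrier H"
    by (force simp: image_iff)+
  then have im: "f ` carrier G = g ` carrier H" using table by simp
  define h where "h = inv_into (carrier H) g \<circ> f"
  have bij: "bij_betw h (carrier G) (carrier H)"
    unfolding h_def
    by (rule bij_betw_trans[of f _ "f ` carrier G"])
       (use inj im in \<open>auto simp: bij_betw_def inj_on_inv_into inv_into_image_cancel\<close>)
  have gh: "g (h a) = f a" if "a \<in> carrier G" for a
  proof -
    have "f a \<in> g ` carrier H" using that im by blast
    then show ?thesis by (simp add: h_def f_inv_into_f)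
  qed
  have hc: "h a \<in> carrier H" if "a \<in> carrier G" for a
    using bij that by (auto simp: bij_betw_def)
  have "h (a \<otimes>\<^bsub>G\<^esub> b) = h a \<otimes>\<^bsub>H\<^esub> h b" if ab: "a \<in> carrier G" "b \<in> carrier G" for a b
  proof -
    have "(f a, f b, f (a \<otimes>\<^bsub>G\<^esub> b)) \<in> ?U"
      using ab by (subst table[symmetric]) (rule image_eqI[of _ _ "(a, b)"], auto)
    then obtain a' b' where *: "a' \<in> carrier H" "b' \<in> carrier H" "f a = g a'" "f b = g b'"
      "f (a \<otimes>\<^bsub>G\<^esub> b) = g (a' \<otimes>\<^bsub>H\<^esub> b')" by auto
    have "a' = h a" "b' = h b"
      using * gh hc ab inj_onD[OF inj(2)] by metis+
    then have "g (h (a \<otimes>\<^bsub>G\<^esub> b)) = g (h a \<otimes>\<^bsub>H\<^esub> h b)"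
      using * gh ab by simp
    then show ?thesis using ab hc inj_onD[OF inj(2)] by (meson G.m_closed H.m_closed)
  qed
  then have "h \<in> iso G H" using bij hc by (auto simp: iso_def hom_def)
  then show ?thesis by (rule is_isoI)
qed

text \<open>The elements of each group can be labelled by numbers below \<open>N\<close>, and there
  are only finitely many sets of triples of such numbers to serve as multiplication tables.\<close>

lemma finitely_many_up_to_iso_if_bounded_order:
  assumes grp: "\<And>G. G \<in> \<G> \<Longrightarrow> group G" and fin: "\<And>G. G \<in> \<G> \<Longrightarrow> finite (carrier G)"
    and ord: "\<And>G. G \<in> \<G> \<Longrightarrow> order G \<le> N"
  shows "finitely_many_up_to_iso \<G>"
proof -
  have "\<exists>f. inj_on f (carrier G) \<and> f ` carrier G \<subseteq> {..<N}" if "G \<in> \<G>" for G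
    using card_le_inj[of "carrier G" "{..<N}"] fin[OF that] ord[OF that] by (auto simp: order_def)
  then obtain f where f: "\<And>G. G \<in> \<G> \<Longrightarrow> inj_on (f G) (carrier G)"
    "\<And>G. G \<in> \<G> \<Longrightarrow> f G ` carrier G \<subseteq> {..<N}" by metis
  define T where "T G = (\<lambda>(a, b). (f G a, f G b, f G (a \<otimes>\<^bsub>G\<^esub> b))) ` (carrier G \<times> carrier G)" for G
  have "T ` \<G> \<subseteq> Pow ({..<N} \<times> {..<N} \<times> {..<N})"
  proof -
    have "T G \<subseteq> {..<N} \<times> {..<N} \<times> {..<N}" if G: "G \<in> \<G>" for G
    proof -
      interpret group G using grp G by blast
      have "f G a < N" if "a \<in> carrier G" for a using f(2)[OF G] that by auto
      then show ?thesis by (auto simp: T_def)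
    qed
    then show ?thesis by blast
  qed
  then have finT: "finite (T ` \<G>)" by (rule finite_subset) simp
  have "equiv \<G> {(G, H). G \<in> \<G> \<and> H \<in> \<G> \<and> G \<cong> H}"
    by (auto simp: equiv_def refl_on_def sym_def trans_def intro: iso_trans group.iso_sym[OF grp])
  then show ?thesis unfolding finitely_many_up_to_iso_def
    using finT by (rule finite_quotient_if_code) (auto simp: T_def intro: is_iso_if_same_table grp f)
qed

section \<open>Irredundant covers by subgroups\<close>

text \<open>Intersect the members of the cover one at a time: a coset \<open>x D\<close> of the current intersection
  \<open>D\<close>, with \<open>x\<close> outside the members used so far, is covered by the others, so one of them meets
  \<open>D\<close> in a subgroup of small index (Neumann, Tomkinson).\<close>

lemma (in group) irredundant_cover_bound:
  assumes fin: "finite (carrier G)" and A: "finite A" "\<And>H. H \<in> A \<Longrightarrow> subgroup H G"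
    and cover: "\<Union>A = carrier G" and irr: "\<And>H. H \<in> A \<Longrightarrow> \<exists>x\<in>H. \<forall>K\<in>A - {H}. x \<notin> K"
  shows "order G \<le> fact (card A) * card (\<Inter>A)"
proof -
  let ?n = "card A"
  \<comment> \<open>Without division this says that the intersection has index at most n (n-1) ...
    (n-k+1). The explicit \<open>carrier G\<close> gives the case \<open>I = {}\<close> its meaning,
    as the empty intersection is the whole type.\<close>
  have step: "\<exists>I\<subseteq>A. card I = k \<and> order G * fact (?n - k) \<le> fact ?n * card (carrier G \<inter> \<Inter>I)"
    if "k \<le> ?n" for k
    using that
  proof (induction k)
    case 0
    then show ?case by (intro exI[of _ "{}"]) (auto simp: order_def)
  next
    case (Suc k)
    then obtain I where I: "I \<subseteq> A" "card I = k"
      and le: "order G * fact (?n - k) \<le> fact ?n * card (carrier G \<inter> \<Inter>I)" by auto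
    define D where "D = carrier G \<inter> \<Inter>I"
    have finI: "finite I" using I A finite_subset by blast
    have "I \<noteq> A" using I Suc.prems by auto
    then obtain J where J: "J \<in> A" "J \<notin> I" using I by blast
    then obtain x where x: "x \<in> J" "\<forall>K\<in>A - {J}. x \<notin> K" using irr by blast
    have xG: "x \<in> carrier G" using x J cover by blast
    have xI: "x \<notin> H" if "H \<in> I" for H using x J I that by blast
    define P where "P H = {d \<in> D. x \<otimes> d \<in> H}" for H
    have DG: "D \<subseteq> carrier G" by (auto simp: D_def)
    have finD: "finite D" using DG fin finite_subset by blast
    \<comment> \<open>A member of \<open>I\<close> contains \<open>D\<close>, so if it met the coset
      x D it would contain x. Hence only members outside \<open>I\<close> can cover that
      coset.\<close>
    have "D \<subseteq> (\<Union>H\<in>A - I. P H)"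
    proof
      fix d assume d: "d \<in> D"
      then have "x \<otimes> d \<in> carrier G" using xG DG by auto
      then obtain H where H: "H \<in> A" "x \<otimes> d \<in> H" using cover by blast
      have "H \<notin> I"
      proof
        assume HI: "H \<in> I"
        interpret H: subgroup H G using A H by blast
        have "d \<in> H" using d HI by (auto simp: D_def)
        then have "x \<otimes> d \<otimes> inv d \<in> H" using H by blast
        moreover have "x \<otimes> d \<otimes> inv d = x" using xG d DG by (auto simp: m_assoc)
        ultimately show False using xI HI by simp
      qed
      then show "d \<in> (\<Union>H\<in>A - I. P H)" using d H by (auto simp: P_def)
    qed
    then have "card D \<le> card (\<Union>H\<in>A - I. P H)"
      by (intro card_mono) (use A finD in \<open>auto simp: P_def\<close>)
    also have "\<dots> \<le> (\<Sum>H\<in>A - I. card (P H))" using A by (intro card_UN_le) auto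
    finally have sum: "card D \<le> (\<Sum>H\<in>A - I. card (P H))" .
    \<comment> \<open>Two elements e, d of \<open>P H\<close> satisfy e^-1 d = (x e)^-1 (x d), which
      lies in H. So left translation by e^-1 embeds \<open>P H\<close> into
      \<open>D \<inter> H\<close>.\<close>
    have PH: "card (P H) \<le> card (D \<inter> H)" if H: "H \<in> A - I" for H
    proof (cases "P H = {}")
      case False
      then obtain e where e: "e \<in> D" "x \<otimes> e \<in> H" by (auto simp: P_def)
      interpret H: subgroup H G using A H by blast
      have eG: "e \<in> carrier G" using e DG by auto
      have "inv e \<otimes> d \<in> D \<inter> H" if d: "d \<in> P H" for d
      proof -
        have dG: "d \<in> carrier G" "d \<in> D" "x \<otimes> d \<in> H" using d DG by (auto simp: P_def)
        have "inv (x \<otimes> e) \<otimes> (x \<otimes> d) = inv e \<otimes> (inv x \<otimes> (x \<otimes> d))"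
          using xG eG dG by (simp add: inv_mult_group m_assoc)
        also have "\<dots> = inv e \<otimes> d"
          using xG eG dG by (simp flip: m_assoc)
        finally have "inv e \<otimes> d \<in> H" using e dG H.m_inv_closed H.m_closed by metis
        moreover have "inv e \<otimes> d \<in> K" if "K \<in> I" for K
        proof -
          interpret K: subgroup K G using A I that by blast
          show ?thesis using e dG that by (auto simp: D_def)
        qed
        ultimately show ?thesis using eG dG by (auto simp: D_def)
      qed
      then show ?thesis
        using finD eG DG
        by (intro card_inj_on_le[of "\<lambda>d. inv e \<otimes> d"])
           (auto simp: inj_on_def P_def subset_iff)
    qed simp
    \<comment> \<open>Pigeonhole: n - k subgroups remain, and together their pieces cover
      \<open>D\<close>.\<close>
    obtain H where H: "H \<in> A - I" "card D \<le> (?n - k) * card (D \<inter> H)"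
    proof (rule ccontr)
      assume *: "\<not> thesis"
      have cAI: "card (A - I) = ?n - k" using I finI by (simp add: card_Diff_subset)
      then have pos: "0 < card (A - I)" using Suc.prems by simp
      have "(\<Sum>H\<in>A - I. card (D \<inter> H)) * (?n - k) = (\<Sum>H\<in>A - I. (?n - k) * card (D \<inter> H))"
        by (simp add: sum_distrib_left mult.commute)
      also have "\<dots> < (\<Sum>H\<in>A - I. card D)"
        using * that A J by (intro sum_strict_mono) (auto simp: not_le[symmetric])
      also have "\<dots> = card D * (?n - k)" using cAI by simp
      finally have "(\<Sum>H\<in>A - I. card (D \<inter> H)) < card D" by simp
      then show False using sum sum_mono[of "A - I" "\<lambda>H. card (P H)" "\<lambda>H. card (D \<inter> H)"] PH
        by fastforce
    qed
    have "order G * fact (?n - k) \<le> fact ?n * ((?n - k) * card (D \<inter> H))"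
      using le H(2) by (metis D_def le_trans mult_le_mono2)
    moreover have "fact (?n - k) = (?n - k) * (fact (?n - Suc k) :: nat)"
      using Suc.prems by (subst fact_reduce) auto
    ultimately have "(?n - k) * (order G * fact (?n - Suc k)) \<le> (?n - k) * (fact ?n * card (D \<inter> H))"
      by (simp add: algebra_simps)
    then have "order G * fact (?n - Suc k) \<le> fact ?n * card (D \<inter> H)"
      using Suc.prems by simp
    then show ?case using H I finI
      by (intro exI[of _ "insert H I"]) (auto simp: D_def Int_ac)
  qed
  obtain I where I: "I \<subseteq> A" "card I = ?n" "order G \<le> fact ?n * card (carrier G \<inter> \<Inter>I)"
    using step[of ?n] by auto
  have "I = A" using I A card_subset_eq by blast
  moreover have "A \<noteq> {}" using cover by auto
  ultimately have "carrier G \<inter> \<Inter>I = \<Inter>A" using A(2) subgroup.subset by fastforce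
  then show ?thesis using I by simp
qed

section \<open>Fixed points of p-groups and growing normalizers\<close>

text \<open>Orbit sizes divide p^k by the orbit-stabilizer theorem. Modulo p only the orbits of size
  1 survive, and these are the fixed points.\<close>

lemma (in group_action) card_fixed_points_cong:
  assumes fin: "finite E" and p: "prime p" and ord: "order G = p ^ k"
  shows "[card {x \<in> E. \<forall>g\<in>carrier G. \<phi> g x = x} = card E] (mod p)"
proof -
  interpret G: group G using group_hom group_hom.axioms(1) by auto
  let ?O = "orbits G E \<phi>" and ?F = "{x \<in> E. \<forall>g\<in>carrier G. \<phi> g x = x}"
  have finO: "finite ?O" using fin by (simp add: orbits_def)
  have orb: "orbit G \<phi> x = {x} \<longleftrightarrow> x \<in> ?F" if "x \<in> E" for x
    using that orbit_refl[OF that] by (auto simp: orbit_def)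
  have "card E = (\<Sum>B\<in>?O. card B)"
    using disjoint_sum[OF fin, of "\<lambda>_. 1::nat"] by simp
  also have "[\<dots> = (\<Sum>B\<in>?O. if B \<in> (\<lambda>x. {x}) ` ?F then 1 else 0)] (mod p)"
  proof (rule cong_sum)
    fix B assume "B \<in> ?O"
    then obtain x where x: "x \<in> E" "B = orbit G \<phi> x" by (auto simp: orbits_def)
    have "card B dvd p ^ k"
      using orbit_stabilizer_theorem[OF x(1)] x ord by (metis dvd_triv_left)
    then obtain i where i: "card B = p ^ i" using p divides_primepow_nat by blast
    show "[card B = (if B \<in> (\<lambda>x. {x}) ` ?F then 1 else 0)] (mod p)"
    proof (cases i)
      case 0
      then obtain y where "B = {y}" using i card_1_singletonE by auto
      then have "B = {x}" using x(2) orbit_refl[OF x(1)] by auto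
      then have "B \<in> (\<lambda>x. {x}) ` ?F" using orb[OF x(1)] x(2) by blast
      then show ?thesis using i 0 by simp
    next
      case (Suc j)
      then have "card B \<noteq> 1" using i p prime_gt_1_nat by auto
      then have "B \<notin> (\<lambda>x. {x}) ` ?F" by auto
      then show ?thesis using Suc i by (simp add: cong_0_iff)
    qed
  qed
  also have "(\<Sum>B\<in>?O. if B \<in> (\<lambda>x. {x}) ` ?F then 1 else 0) = card (?O \<inter> (\<lambda>x. {x}) ` ?F)"
    using finO by (simp add: sum.If_cases)
  also have "?O \<inter> (\<lambda>x. {x}) ` ?F = (\<lambda>x. {x}) ` ?F"
    using orb by (force simp: orbits_def)
  also have "card \<dots> = card ?F" by (simp add: card_image)
  finally show ?thesis by (rule cong_sym)
qed

text \<open>The inverse turns multiplication on the right into a left action. The restricted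
  abstraction is there because the elements of \<open>BijGroup\<close> are extensional
  functions.\<close>

lemma (in group) right_coset_action:
  assumes H: "subgroup H G"
  shows "group_action G (rcosets H) (\<lambda>g. \<lambda>M\<in>rcosets H. M #> inv g)"
proof -
  have sub: "M \<subseteq> carrier G" if "M \<in> rcosets H" for M
    using that H subgroup.rcosets_carrier is_group by blast
  have closed: "M #> g \<in> rcosets H" if "M \<in> rcosets H" "g \<in> carrier G" for M g
  proof -
    obtain a where "a \<in> carrier G" "M = H #> a" using \<open>M \<in> _\<close> by (auto simp: RCOSETS_def)
    then show ?thesis
      using that subgroup.subset[OF H] by (simp add: coset_mult_assoc rcosetsI)
  qed
  have bij: "bij_betw (\<lambda>M. M #> inv g) (rcosets H) (rcosets H)" if g: "g \<in> carrier G" for g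
    by (rule bij_betw_byWitness[where f' = "\<lambda>M. M #> g"])
       (use g sub closed in \<open>auto simp: coset_mult_assoc\<close>)
  show ?thesis
    unfolding group_action_def group_hom_def group_hom_axioms_def
  proof (intro conjI homI)
    fix g assume "g \<in> carrier G"
    then show "(\<lambda>M\<in>rcosets H. M #> inv g) \<in> carrier (BijGroup (rcosets H))"
      using bij by (simp add: BijGroup_def Bij_def bij_betw_restrict_eq)
  next
    fix g h assume gh: "g \<in> carrier G" "h \<in> carrier G"
    have "(\<lambda>M\<in>rcosets H. M #> inv k) \<in> Bij (rcosets H)" if "k \<in> carrier G" for k
      using bij that by (simp add: Bij_def bij_betw_restrict_eq)
    then show "(\<lambda>M\<in>rcosets H. M #> inv (g \<otimes> h)) =
        (\<lambda>M\<in>rcosets H. M #> inv g) \<otimes>\<^bsub>BijGroup (rcosets H)\<^esub> (\<lambda>M\<in>rcosets H. M #> inv h)"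
      using gh sub closed
      by (auto simp: BijGroup_def compose_def inv_mult_group coset_mult_assoc restrict_def fun_eq_iff)
  qed (auto simp: is_group group_BijGroup)
qed

text \<open>Count the fixed points of \<open>H\<close> on its right cosets: these are the cosets of elements normalizing \<open>H\<close>.\<close>

lemma (in group) normalizer_grows:
  assumes p: "prime p" and ord: "order G = p ^ k" and H: "subgroup H G" "H \<noteq> carrier G"
  shows "\<exists>y\<in>carrier G - H. \<forall>h\<in>H. y \<otimes> h \<otimes> inv y \<in> H"
proof -
  interpret H: subgroup H G by fact
  have "0 < order G" using ord p prime_gt_0_nat by simp
  then have fin: "finite (carrier G)" by (simp add: order_gt_0_iff_finite)
  interpret group_action G "rcosets H" "\<lambda>g. \<lambda>M\<in>rcosets H. M #> inv g"
    by (rule right_coset_action[OF H(1)])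
  define F where "F = {M \<in> rcosets H. \<forall>g\<in>H. M #> inv g = M}"
  have finR: "finite (rcosets H)" using fin by (simp add: RCOSETS_def)
  have lag: "card (rcosets H) * card H = p ^ k" using lagrange[OF H(1)] ord by simp
  obtain j where j: "card H = p ^ j" using lag p divides_primepow_nat by (metis dvd_triv_right)
  obtain i where i: "card (rcosets H) = p ^ i" using lag p divides_primepow_nat by (metis dvd_triv_left)
  have "i \<noteq> 0"
  proof
    assume "i = 0"
    then have "card H = card (carrier G)" using lag i ord by (simp add: order_def)
    then show False using H card_subset_eq fin H.subset by blast
  qed
  have "[card F = card (rcosets H)] (mod p)"
    using group_action.card_fixed_points_cong[OF induced_action[OF H(1)] finR p, of j] j
    by (simp add: order_def F_def cong: conj_cong)
  moreover have "p dvd card (rcosets H)" using i \<open>i \<noteq> 0\<close> by simp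
  ultimately have "p dvd card F" using cong_dvd_iff by blast
  \<comment> \<open>The trivial coset is fixed, so the number of fixed points is a positive multiple
    of p and a second fixed coset exists.\<close>
  moreover have "H \<in> F"
    using rcosetsI[OF H.subset one_closed] H.subset coset_join2[OF _ H(1)] by (auto simp: F_def)
  then have "F \<noteq> {}" "finite F" using finR by (auto simp: F_def)
  ultimately have "p \<le> card F" by (simp add: dvd_imp_le card_gt_0_iff)
  then have "1 < card F" using prime_ge_2_nat[OF p] by linarith
  have "\<not> F \<subseteq> {H}"
  proof
    assume "F \<subseteq> {H}"
    then have "card F \<le> card {H}" by (intro card_mono) auto
    then show False using \<open>1 < card F\<close> by simp
  qed
  then obtain M where M: "M \<in> rcosets H" "\<forall>g\<in>H. M #> inv g = M" "M \<noteq> H" by (auto simp: F_def)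
  then obtain y where y: "y \<in> carrier G" "M = H #> y" by (auto simp: RCOSETS_def)
  have "y \<notin> H" using M y H(1) coset_join2 by blast
  moreover have "y \<otimes> h \<otimes> inv y \<in> H" if h: "h \<in> H" for h
  proof -
    \<comment> \<open>The action multiplies by inverses, so it is the element \<open>inv h\<close>
      that yields H y h = H y, that is, y h y^-1 in H.\<close>
    have "M #> inv (inv h) = M" using M(2) h H.m_inv_closed by blast
    then have "H #> (y \<otimes> h) = H #> y"
      using y h H.subset H.mem_carrier by (simp add: coset_mult_assoc)
    then have "y \<otimes> h \<in> H #> y"
      using y h rcos_self[OF _ H(1)] by (metis H.mem_carrier m_closed)
    then show ?thesis using y H.rcos_module_imp is_group by blast
  qed
  ultimately show ?thesis using y by blast
qed

section \<open>Cyclic subgroups and powers of a generator\<close>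

lemma (in group) cyclic_subgroup_iff_generate:
  "cyclic_subgroup H G \<longleftrightarrow> (\<exists>x\<in>carrier G. H = generate G {x})"
proof
  assume "cyclic_subgroup H G"
  then have H: "subgroup H G" and "cyclic_group (G\<lparr>carrier := H\<rparr>)"
    by (auto simp: cyclic_subgroup_def)
  then obtain x where x: "x \<in> H" "subgroup_generated (G\<lparr>carrier := H\<rparr>) {x} = G\<lparr>carrier := H\<rparr>"
    by (auto simp: cyclic_group_def)
  then have "H = generate (G\<lparr>carrier := H\<rparr>) (H \<inter> {x})"
    using carrier_subgroup_generated[of "G\<lparr>carrier := H\<rparr>" "{x}"] by simp
  then have "H = generate G {x}" using x(1) H generate_consistent[of "{x}" H] by simp
  then show "\<exists>x\<in>carrier G. H = generate G {x}" using x(1) H subgroup.mem_carrier by metis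
next
  assume "\<exists>x\<in>carrier G. H = generate G {x}"
  then obtain x where "x \<in> carrier G" "H = generate G {x}" by blast
  then show "cyclic_subgroup H G"
    using cyclic_group_generated[of x] generate_is_subgroup[of "{x}"]
    by (simp add: cyclic_subgroup_def subgroup_generated_def)
qed

lemma (in group) cyclic_group_iff_generate:
  "cyclic_group G \<longleftrightarrow> (\<exists>x\<in>carrier G. carrier G = generate G {x})"
proof -
  have "generate G {x} = range (\<lambda>n::int. x [^] n)" if "x \<in> carrier G" for x
    using generate_pow[OF that] by auto
  then show ?thesis by (auto simp: cyclic_group)
qed

lemma (in group) generate_singleton_subset:
  assumes "g \<in> carrier G" "x \<in> generate G {g}"
  shows "generate G {x} \<subseteq> generate G {g}"
  using assms by (intro generate_subgroup_incl[OF _ generate_is_subgroup]) auto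

lemma (in group) ex_maximal_cyclic_subgroup:
  assumes fin: "finite (carrier G)" and x: "x \<in> carrier G"
  obtains M where "maximal_cyclic_subgroup M G" "x \<in> M"
proof -
  have "finite {H. cyclic_subgroup H G}"
    by (rule finite_subset[of _ "Pow (carrier G)"])
       (use fin subgroup.subset in \<open>auto simp: cyclic_subgroup_def\<close>)
  moreover have "generate G {x} \<in> {H. cyclic_subgroup H G}"
    using x by (auto simp: cyclic_subgroup_iff_generate)
  ultimately obtain M where "cyclic_subgroup M G" "generate G {x} \<subseteq> M"
    "\<And>K. cyclic_subgroup K G \<Longrightarrow> M \<subseteq> K \<Longrightarrow> M = K"
    using finite_has_maximal2[of "{H. cyclic_subgroup H G}" "generate G {x}"] by auto
  then show thesis
    using that[of M] generate.incl[of x "{x}" G] by (auto simp: maximal_cyclic_subgroup_def)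
qed

lemma (in group) nat_pow_eq_iff_cong:
  fixes m n :: nat
  assumes "x \<in> carrier G"
  shows "x [^] m = x [^] n \<longleftrightarrow> [m = n] (mod ord x)"
proof -
  have "x [^] m = x [^] n \<longleftrightarrow> x [^] int n = x [^] int m" by (auto simp: int_pow_int)
  also have "\<dots> \<longleftrightarrow> [int m = int n] (mod int (ord x))"
    using int_pow_eq[OF assms] by (simp add: cong_iff_dvd_diff)
  finally show ?thesis by (simp add: cong_int_iff)
qed

text \<open>For x = g^i with i < ord g the condition says that ord g divides i p. The quotient i p /
  ord g is less than p and determines i.\<close>

lemma (in group) card_roots_of_unity_in_cyclic:
  assumes fin: "finite (carrier G)" and g: "g \<in> carrier G" and p: "0 < p"
  shows "card {x \<in> generate G {g}. x [^] p = \<one>} \<le> p"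
proof -
  have pos: "0 < ord g" using ord_ge_1[OF fin g] by simp
  let ?J = "{i. i < ord g \<and> ord g dvd i * p}"
  have "{x \<in> generate G {g}. x [^] p = \<one>} \<subseteq> (\<lambda>i. g [^] i) ` ?J"
  proof
    fix x assume "x \<in> {x \<in> generate G {g}. x [^] p = \<one>}"
    then have x: "x \<in> generate G {g}" "x [^] p = \<one>" by auto
    then obtain k :: nat where k: "x = g [^] k"
      using generate_pow_on_finite_carrier[OF fin g] by blast
    have "g [^] (k mod ord g) = g [^] k"
      using g by (simp add: nat_pow_eq_iff_cong)
    moreover from this have "ord g dvd (k mod ord g) * p"
      using x k g by (metis nat_pow_closed nat_pow_pow pow_eq_id)
    ultimately show "x \<in> (\<lambda>i. g [^] i) ` ?J"
      using k pos by (intro image_eqI[of _ _ "k mod ord g"]) auto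
  qed
  then have "card {x \<in> generate G {g}. x [^] p = \<one>} \<le> card ?J"
    by (intro surj_card_le) auto
  also have "\<dots> \<le> card {..<p}"
  proof (rule card_inj_on_le[of "\<lambda>i. i * p div ord g"])
    show "inj_on (\<lambda>i. i * p div ord g) ?J"
      using p pos by (auto simp: inj_on_def dvd_div_eq_iff)
    show "(\<lambda>i. i * p div ord g) ` ?J \<subseteq> {..<p}"
      using p pos by (auto simp: less_mult_imp_div_less mult.commute)
  qed simp
  finally show ?thesis by simp
qed

section \<open>A central element of order divisible by p^2 forces cyclicity\<close>

lemma (in group) semidirect_commute:
  fixes u t :: nat
  assumes cy: "c \<in> carrier G" "y \<in> carrier G" and conj: "y \<otimes> c = c [^] u \<otimes> y"
  shows "y \<otimes> c [^] t = c [^] (u * t) \<otimes> y"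
proof (induction t)
  case (Suc t)
  have "y \<otimes> c [^] Suc t = y \<otimes> c [^] t \<otimes> c" using cy by (simp add: m_assoc)
  also have "\<dots> = c [^] (u * t) \<otimes> (y \<otimes> c)" using cy Suc by (simp add: m_assoc)
  also have "\<dots> = c [^] (u * t) \<otimes> c [^] u \<otimes> y" using cy conj by (simp add: m_assoc)
  finally show ?case using cy by (simp add: nat_pow_mult add.commute)
qed (use cy in simp)

text \<open>All factors y are moved to the right. The i-th block c^t (counting from 0) has i of them
  on its left and becomes c^(u^i t), whence the geometric sum.\<close>

lemma (in group) semidirect_power:
  fixes u t j :: nat
  assumes cy: "c \<in> carrier G" "y \<in> carrier G" and conj: "y \<otimes> c = c [^] u \<otimes> y"
  shows "(c [^] t \<otimes> y) [^] j = c [^] (t * (\<Sum>i<j. u ^ i)) \<otimes> y [^] j"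
proof -
  note 1 = semidirect_commute[OF assms]
  have 2: "y [^] j \<otimes> c [^] t = c [^] (u ^ j * t) \<otimes> y [^] j" for j t :: nat
  proof (induction j arbitrary: t)
    case (Suc j)
    have "y [^] Suc j \<otimes> c [^] t = y [^] j \<otimes> c [^] (u * t) \<otimes> y"
      using cy 1 by (simp add: m_assoc)
    also have "\<dots> = c [^] (u ^ j * (u * t)) \<otimes> y [^] Suc j"
      using cy Suc by (simp add: m_assoc)
    finally show ?case by (simp add: ac_simps)
  qed (use cy in simp)
  show ?thesis
  proof (induction j)
    case (Suc j)
    have "(c [^] t \<otimes> y) [^] Suc j = c [^] (t * (\<Sum>i<j. u ^ i)) \<otimes> (y [^] j \<otimes> c [^] t) \<otimes> y"
      using cy Suc by (simp add: m_assoc)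
    also have "\<dots> = c [^] (t * (\<Sum>i<j. u ^ i)) \<otimes> c [^] (u ^ j * t) \<otimes> y [^] Suc j"
      unfolding 2 using cy by (simp add: m_assoc)
    finally show ?case using cy by (simp add: nat_pow_mult algebra_simps)
  qed (use cy in simp)
qed

lemma geometric_sum_cong:
  fixes u p :: nat
  assumes "[u = 1] (mod m)"
  shows "[(\<Sum>i<p. u ^ i) = p] (mod m)"
proof -
  have "[(\<Sum>i<p. u ^ i) = (\<Sum>i<p. 1)] (mod m)"
    using cong_pow[OF assms] by (intro cong_sum) simp
  then show ?thesis by simp
qed

text \<open>A cyclic subgroup \<open>C = \<langle>c\<rangle>\<close> of maximal order that contains \<open>z\<close> is the whole group: otherwise some
  \<open>y\<close> outside \<open>C\<close> acts on \<open>C\<close> by \<open>c \<mapsto> c\<^sup>u\<close> and has \<open>y\<^sup>p \<in> C\<close>. Since \<open>z\<close> is central, \<open>u \<equiv> 1\<close> modulo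
  \<open>p\<^sup>2\<close>, so \<open>1 + u + \<dots> + u\<^bsup>p-1\<^esup>\<close> is \<open>p\<close> times a unit and a suitable \<open>c\<^sup>t y\<close> has order \<open>p\<close>. It lies in
  a cyclic group together with \<open>z\<close>, hence in \<open>\<langle>z\<rangle> \<subseteq> C\<close>.\<close>

lemma (in group) cyclic_if_common_power_of_order_square:
  assumes p: "prime p" and ordG: "order G = p ^ k"
    and z: "z \<in> carrier G" "p\<^sup>2 dvd ord z"
    and common: "\<And>x. x \<in> carrier G \<Longrightarrow> \<exists>g\<in>carrier G. x \<in> generate G {g} \<and> z \<in> generate G {g}"
  shows "cyclic_group G"
proof (rule ccontr)
  assume noncyclic: "\<not> cyclic_group G"
  have "0 < order G" using ordG p prime_gt_0_nat by simp
  then have fin: "finite (carrier G)" by (simp add: order_gt_0_iff_finite)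
  note gen = generate_pow_on_finite_carrier[OF fin]
  have p0: "0 < p" using p prime_gt_0_nat by blast
  have central: "y \<otimes> z = z \<otimes> y" if y: "y \<in> carrier G" for y
  proof -
    obtain g where g: "g \<in> carrier G" "y \<in> generate G {g}" "z \<in> generate G {g}" using common y by blast
    then obtain i j :: nat where "y = g [^] i" "z = g [^] j" using gen by blast
    then show ?thesis using g by (simp add: nat_pow_mult add.commute)
  qed
  define S where "S = {g \<in> carrier G. z \<in> generate G {g}}"
  have "finite S" "S \<noteq> {}" using fin common[OF z(1)] by (auto simp: S_def)
  then obtain c where c: "c \<in> S" "\<And>g. g \<in> S \<Longrightarrow> ord g \<le> ord c"
    using obtains_MAX[of S ord] by (metis Max_ge finite_imageI imageI)
  define C where "C = generate G {c}"
  have cG: "c \<in> carrier G" and zC: "z \<in> C" using c by (auto simp: S_def C_def)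
  have subC: "subgroup C G" unfolding C_def using cG by (intro generate_is_subgroup) auto
  interpret C: subgroup C G by (fact subC)
  have cC: "c \<in> C" by (auto simp: C_def intro: generate.incl)
  \<comment> \<open>A cyclic group containing c also contains z, so its generator competes with c in
    the choice of maximal order.\<close>
  have maxC: "generate G {g} = C" if g: "g \<in> carrier G" "c \<in> generate G {g}" for g
  proof -
    have sub: "C \<subseteq> generate G {g}" unfolding C_def by (rule generate_singleton_subset[OF g])
    then have "ord g \<le> ord c" using c(2) g zC by (auto simp: S_def)
    then have "card (generate G {g}) \<le> card C"
      using generate_pow_card g cG by (simp add: C_def)
    moreover have "finite (generate G {g})"
      using generate_incl[of "{g}"] g fin finite_subset by blast
    ultimately show ?thesis using sub card_seteq by blast
  qed
  have "C \<noteq> carrier G" using noncyclic cG cyclic_group_iff_generate by (auto simp: C_def)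
  then obtain y0 where y0: "y0 \<in> carrier G - C" "\<forall>h\<in>C. y0 \<otimes> h \<otimes> inv y0 \<in> C"
    using normalizer_grows[OF p ordG subC] by blast
  have y0p: "y0 [^] (p ^ k) \<in> C" using y0 pow_order_eq_1 ordG by (metis C.one_closed DiffD1)
  \<comment> \<open>The last iterated p-th power of \<open>y0\<close> before entering C is outside C
    while its own p-th power is inside. As a power of \<open>y0\<close> it still normalizes
    C.\<close>
  define i where "i = (LEAST i. y0 [^] (p ^ i) \<in> C)"
  have i: "y0 [^] (p ^ i) \<in> C" "\<And>j. j < i \<Longrightarrow> y0 [^] (p ^ j) \<notin> C"
    using LeastI[of "\<lambda>i. y0 [^] (p ^ i) \<in> C", OF y0p] not_less_Least by (auto simp: i_def)
  have "i \<noteq> 0" using i(1) y0 by (cases i) auto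
  then obtain j where j: "i = Suc j" by (cases i) auto
  define y where "y = y0 [^] (p ^ j)"
  have yG: "y \<in> carrier G" and yC: "y \<notin> C" using y0 i(2) j by (auto simp: y_def)
  have ypC: "y [^] p \<in> C" using i(1) j y0 by (simp add: y_def nat_pow_pow mult.commute)
  have "y0 [^] n \<otimes> h \<otimes> inv (y0 [^] n) \<in> C" if "h \<in> C" for n :: nat and h
    using that
  proof (induction n arbitrary: h)
    case (Suc n)
    have "y0 [^] n \<otimes> (y0 \<otimes> h \<otimes> inv y0) \<otimes> inv (y0 [^] n) \<in> C" using Suc y0 by blast
    moreover have "y0 [^] n \<otimes> (y0 \<otimes> h \<otimes> inv y0) \<otimes> inv (y0 [^] n) = y0 [^] Suc n \<otimes> h \<otimes> inv (y0 [^] Suc n)"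
      using y0 Suc.prems by (simp add: m_assoc inv_mult_group)
    ultimately show ?case by simp
  qed simp
  then have "y \<otimes> c \<otimes> inv y \<in> C" using cC by (simp add: y_def)
  then obtain u :: nat where u: "y \<otimes> c \<otimes> inv y = c [^] u" using gen[OF cG] by (auto simp: C_def)
  have conj: "y \<otimes> c = c [^] u \<otimes> y" using u cG yG by (metis inv_solve_right' m_closed nat_pow_closed)
  note pow = semidirect_power[OF cG yG conj]
  obtain e :: nat where e: "z = c [^] e" using zC gen[OF cG] by (auto simp: C_def)
  obtain s :: nat where s: "y [^] p = c [^] s" using ypC gen[OF cG] by (auto simp: C_def)
  obtain n where n: "ord c = p ^ n"
    using ord_dvd_group_order[OF cG] ordG p divides_primepow_nat by auto

  have "[u = 1] (mod p\<^sup>2)"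
  proof -
    have "z \<otimes> y = z [^] u \<otimes> y"
      using semidirect_commute[OF cG yG conj, of e] central[OF yG] cG by (simp add: e nat_pow_pow mult.commute)
    then have "z [^] u = z [^] (1::nat)" using z(1) yG by simp
    then have "[u = 1] (mod ord z)" using z(1) nat_pow_eq_iff_cong by blast
    then show ?thesis using z(2) by (rule cong_dvd_modulus_nat)
  qed
  then have S: "[(\<Sum>i<p. u ^ i) = p] (mod p\<^sup>2)" by (rule geometric_sum_cong)
  then have "[(\<Sum>i<p. u ^ i) = p] (mod p)" by (rule cong_dvd_modulus_nat) simp
  then have "p dvd (\<Sum>i<p. u ^ i)" by (simp add: cong_dvd_iff)
  then obtain w where w: "(\<Sum>i<p. u ^ i) = p * w" ..
  \<comment> \<open>Here the precision p^2 is spent: after one factor p is cancelled, w is still 1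
    modulo p, hence invertible modulo the p-power \<open>ord c\<close>.\<close>
  have "[p * w = p * 1] (mod p * p)" using S by (simp add: w power2_eq_square)
  then have "[w = 1] (mod p)" using p0 unfolding cong_def mult_mod_right[symmetric] by simp
  then have "coprime w p" using cong_imp_coprime[of 1 w p] cong_sym by auto
  then have "coprime w (ord c)" by (simp add: n)
  then obtain w' where w': "[w * w' = 1] (mod ord c)" using cong_solve_coprime_nat by auto

  \<comment> \<open>Otherwise y^p would generate C, so <y> would be a cyclic group containing C and
    equal to it by maximality, although y is outside C.\<close>
  have "p dvd s"
  proof (rule ccontr)
    assume "\<not> p dvd s"
    then have "coprime s (ord c)" using p by (simp add: n prime_imp_coprime coprime_commute)
    then obtain s' where "[s * s' = 1] (mod ord c)" using cong_solve_coprime_nat by auto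
    then have "c [^] (s * s') = c [^] (1::nat)"
      using nat_pow_eq_iff_cong[OF cG, of "s * s'" 1] by simp
    then have "c = y [^] (p * s')" using cG yG s by (simp add: nat_pow_pow[symmetric])
    then have "c \<in> generate G {y}" using gen[OF yG] by blast
    then have "generate G {y} = C" using maxC yG by blast
    then show False using yC generate.incl[of y "{y}" G] by auto
  qed
  then obtain s' where s': "s = p * s'" ..
  \<comment> \<open>The exponent solves t p w + s = 0 modulo \<open>ord c\<close>, where x^p = c^(t
    p w + s): \<open>w'\<close> inverts w, p s' is s, and \<open>ord c - 1\<close> stands for -1 in
    the natural numbers.\<close>
  define t where "t = w' * s' * (ord c - 1)"
  define x where "x = c [^] t \<otimes> y"
  have "[t * (p * w) + s = 0] (mod ord c)"
  proof -
    have "ord c - 1 + 1 = ord c" using ord_ge_1[OF fin cG] by simp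
    then have "t * (p * w) + s = (w * w') * (s * (ord c - 1)) + s"
      by (simp add: t_def s' algebra_simps)
    moreover have "[(w * w') * (s * (ord c - 1)) + s = 1 * (s * (ord c - 1)) + s] (mod ord c)"
      by (intro cong_add cong_mult w') auto
    moreover have "1 * (s * (ord c - 1)) + s = s * ord c"
      using \<open>ord c - 1 + 1 = ord c\<close> by (metis mult.left_neutral distrib_left mult.right_neutral)
    ultimately show ?thesis by (metis cong_0_iff cong_dvd_iff dvd_triv_right)
  qed
  then have "c [^] (t * (p * w) + s) = \<one>" using cG by (simp add: pow_eq_id cong_0_iff)
  then have xp: "x [^] p = \<one>" using pow[of t p] cG by (simp add: x_def w s nat_pow_mult)
  have xG: "x \<in> carrier G" using cG yG by (simp add: x_def)
  have xC: "x \<notin> C"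
  proof
    assume "x \<in> C"
    moreover have "c [^] t \<in> C" unfolding C_def gen[OF cG] by blast
    ultimately have "inv (c [^] t) \<otimes> x \<in> C" by simp
    moreover have "inv (c [^] t) \<otimes> x = y" using cG yG by (simp add: x_def m_assoc[symmetric])
    ultimately show False using yC by simp
  qed
  obtain g where g: "g \<in> carrier G" "x \<in> generate G {g}" "z \<in> generate G {g}"
    using common xG by blast
  \<comment> \<open>The subgroup <v> of <z> has p elements, all with trivial p-th power. The cyclic
    group <g> has at most p such elements, so <v> contains them all, among them x.\<close>
  define v where "v = z [^] (ord z div p)"
  have pz: "p dvd ord z" using z(2) by (meson dvd_trans dvd_power pos2)
  have vG: "v \<in> carrier G" using z by (simp add: v_def)
  have ordv: "ord v = p"
  proof -
    have "0 < ord z" using ord_ge_1[OF fin z(1)] by simp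
    then show ?thesis unfolding v_def using ord_pow[OF z(1), of "ord z div p"] pz p0
      by (auto elim!: dvdE)
  qed
  have vz: "v \<in> generate G {z}" using gen[OF z(1)] by (auto simp: v_def)
  then have "generate G {v} \<subseteq> generate G {z}" using z generate_singleton_subset by blast
  also have "generate G {z} \<subseteq> generate G {g}" using g generate_singleton_subset by blast
  finally have "generate G {v} \<subseteq> generate G {g}" .
  moreover have "a [^] p = \<one>" if "a \<in> generate G {v}" for a
    using that gen[OF vG] ordv vG by (auto simp: nat_pow_pow pow_eq_id)
  ultimately have "generate G {v} \<subseteq> {a \<in> generate G {g}. a [^] p = \<one>}" by blast
  moreover have "card {a \<in> generate G {g}. a [^] p = \<one>} \<le> card (generate G {v})"
    using card_roots_of_unity_in_cyclic[OF fin g(1) p0] ordv generate_pow_card[OF vG] by simp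
  moreover have "finite {a \<in> generate G {g}. a [^] p = \<one>}"
    by (rule finite_subset[OF _ fin]) (use generate_incl[of "{g}"] g in blast)
  ultimately have "generate G {v} = {a \<in> generate G {g}. a [^] p = \<one>}"
    using card_seteq by blast
  then have "x \<in> generate G {v}" using g xp by blast
  also have "\<dots> \<subseteq> generate G {z}" using vz z generate_singleton_subset by blast
  also have "\<dots> \<subseteq> C" using zC subC by (intro generate_subgroup_incl) auto
  finally show False using xC by blast
qed

section \<open>The bound on the order and the theorem\<close>

lemma (in group) order_le_fact_square:
  assumes p: "prime p" and ordG: "order G = p ^ k" and noncyclic: "\<not> cyclic_group G"
  shows "order G \<le> (fact (num_maximal_cyclic G))\<^sup>2"
proof -
  have "0 < order G" using ordG p prime_gt_0_nat by simp
  then have fin: "finite (carrier G)" by (simp add: order_gt_0_iff_finite)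
  define A where "A = {H. maximal_cyclic_subgroup H G}"
  define D where "D = \<Inter>A"
  have p0: "0 < p" using p prime_gt_0_nat by blast
  have sub: "subgroup H G" and ex_gen: "\<exists>g\<in>carrier G. H = generate G {g}" if "H \<in> A" for H
    using that cyclic_subgroup_iff_generate
    by (auto simp: A_def maximal_cyclic_subgroup_def cyclic_subgroup_def)
  have ex: "\<exists>M\<in>A. x \<in> M" if "x \<in> carrier G" for x
    using ex_maximal_cyclic_subgroup[OF fin that] by (metis A_def mem_Collect_eq)
  have "finite A" by (rule finite_subset[of _ "Pow (carrier G)"]) (use fin sub subgroup.subset in auto)
  have bound: "order G \<le> fact (card A) * card D" unfolding D_def
  proof (rule irredundant_cover_bound[OF fin \<open>finite A\<close> sub])
    show "\<Union>A = carrier G" using ex sub subgroup.subset by blast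
  next
    fix H assume H: "H \<in> A"
    then obtain g where g: "g \<in> carrier G" "H = generate G {g}" using ex_gen by blast
    have "g \<notin> K" if K: "K \<in> A - {H}" for K
    proof
      assume "g \<in> K"
      then have "H \<subseteq> K" unfolding g(2) using K sub by (intro generate_subgroup_incl) auto
      then show False using K H by (auto simp: A_def maximal_cyclic_subgroup_def)
    qed
    then show "\<exists>x\<in>H. \<forall>K\<in>A - {H}. x \<notin> K" using g generate.incl[of g "{g}" G] by blast
  qed
  obtain M where M: "M \<in> A" using ex[OF one_closed] by blast
  then obtain g where g: "g \<in> carrier G" "M = generate G {g}" using ex_gen by blast
  have subD: "subgroup D G" unfolding D_def using M sub by (intro subgroups_Inter) auto
  have DM: "D \<subseteq> M" using M by (auto simp: D_def)
  have finM: "finite M" using fin sub[OF M] subgroup.subset finite_subset by blast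
  have roots: "z [^] p = \<one>" if z: "z \<in> D" for z
  proof (rule ccontr)
    assume ne: "z [^] p \<noteq> \<one>"
    have zG: "z \<in> carrier G" using z subD subgroup.mem_carrier by metis
    obtain i where i: "ord z = p ^ i"
      using ord_dvd_group_order[OF zG] ordG p divides_primepow_nat by auto
    have "\<not> ord z dvd p" using ne zG pow_eq_id by blast
    then have "2 \<le> i" using i by (cases i; cases "i - 1") auto
    then have "p\<^sup>2 dvd ord z" using i by (simp add: le_imp_power_dvd)
    moreover have "\<exists>g\<in>carrier G. x \<in> generate G {g} \<and> z \<in> generate G {g}" if "x \<in> carrier G" for x
      using ex[OF that] ex_gen z by (metis D_def InterD)
    ultimately have "cyclic_group G"
      using cyclic_if_common_power_of_order_square[OF p ordG zG] by blast
    then show False using noncyclic by blast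
  qed
  have "card D \<le> card {x \<in> generate G {g}. x [^] p = \<one>}"
    using DM roots g finM by (intro card_mono) auto
  then have Dp: "card D \<le> p" using card_roots_of_unity_in_cyclic[OF fin g(1) p0] by simp
  have "D \<noteq> carrier G"
  proof
    assume "D = carrier G"
    then have "M = carrier G" using DM sub[OF M] subgroup.subset by blast
    then show False using g noncyclic cyclic_group_iff_generate by blast
  qed
  have lag: "card (rcosets D) * card D = p ^ k" using lagrange[OF subD] ordG by simp
  then obtain i where i: "card (rcosets D) = p ^ i" using p divides_primepow_nat by (metis dvd_triv_left)
  have "i \<noteq> 0"
  proof
    assume "i = 0"
    then have "card D = card (carrier G)" using lag i ordG by (simp add: order_def)
    then show False using \<open>D \<noteq> carrier G\<close> card_subset_eq fin subD subgroup.subset by blast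
  qed
  then have "p \<le> card (rcosets D)" using i p0 self_le_power[of p i] by simp
  \<comment> \<open>The index bound is used in product form: p |D| \<le> |G| \<le> n! |D| with n the
    number of maximal cyclic subgroups, and |D| cancels.\<close>
  then have "p * card D \<le> order G" using lag ordG by (metis mult_le_mono1)
  also note bound
  finally have "p \<le> fact (card A)"
    using \<open>0 < order G\<close> bound by (metis bot_nat_0.not_eq_extremum mult_0_right mult_le_cancel2 not_le)
  \<comment> \<open>One factorial bounds the index of D, the other bounds |D| by way of p.\<close>
  then have "order G \<le> fact (card A) * fact (card A)"
    using bound Dp by (meson le_trans mult_le_mono2)
  then show ?thesis by (simp add: num_maximal_cyclic_def A_def power2_eq_square)
qed

theorem theorem1p2:
  shows "maximal_cyclic_bounded (noncyclic_prime_power_groups :: 'a monoid set)"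
  unfolding maximal_cyclic_bounded_def
proof (intro conjI ballI allI)
  fix n :: nat
  show "finitely_many_up_to_iso {G \<in> noncyclic_prime_power_groups :: 'a monoid set. num_maximal_cyclic G \<le> n}"
  proof (rule finitely_many_up_to_iso_if_bounded_order[where N = "(fact n)\<^sup>2"])
    fix G :: "'a monoid"
    assume G: "G \<in> {G \<in> noncyclic_prime_power_groups. num_maximal_cyclic G \<le> n}"
    then obtain p k where "prime p" "order G = p ^ k" "\<not> cyclic_group G" "group G"
      by (auto simp: noncyclic_prime_power_groups_def)
    then have "order G \<le> (fact (num_maximal_cyclic G))\<^sup>2"
      by (intro group.order_le_fact_square)
    also have "\<dots> \<le> (fact n)\<^sup>2" using G by (intro power_mono fact_mono) auto
    finally show "order G \<le> (fact n)\<^sup>2" .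
  qed (auto simp: noncyclic_prime_power_groups_def)
qed (auto simp: noncyclic_prime_power_groups_def)

end
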